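(* Let $N\ge1$ be an integer and let $s\in\mathbb{R}$ with $s>-\frac12$. Then the one-point density function $\boldsymbol{\rho}_N^{(s)}(x)$ of the generalized Cauchy ensemble satisfies the third order differential equation $\mathsf{D}\boldsymbol{\rho}_N^{(s)}(x)=0$, where $\mathsf{D}$ is the differential operator given by $$\begin{aligned}(\mathsf{D}y)(x)={}&(1+x^2)^3y'''(x)+8x(1+x^2)^2y''(x)\\&+2(1+x^2)\left(3+2N(N+2s)+(7-2s^2)x^2\right)y'(x)\\&+4x\left(1+s^2+2N(N+2s)+(1-s^2)x^2\right)y(x).\end{aligned}$$
   Context: For real $s>-\frac12$, the generalized Cauchy ensemble is the probability measure on $N\times N$ complex Hermitian matrices proportional to $\det\left((1+\mathbf{X}^2)^{-s-N}\right)d\mathbf{X}$ ($d\mathbf{X}$ Lebesgue measure). Its one-point density function is $\boldsymbol{\rho}_N^{(s)}(x)=\mathbb{E}_N^{(s)}\left(\sum_{j=1}^N\delta(x-x_j)\right)$, where $x_1,\dots,x_N$ are the eigenvalues; explicitly, with $\phi_N^{(s)}(x)=(1+x^2)^{-s-N}$ and $p_0^{(s,N)},p_1^{(s,N)},\dots,p_{N-1}^{(s,N)}$ the monic orthogonal polynomials ($\deg p_j^{(s,N)}=j$) with respect to the weight $\phi_N^{(s)}$ on $\mathbb{R}$, $$\boldsymbol{\rho}_N^{(s)}(x)=\phi_N^{(s)}(x)\sum_{j=0}^{N-1}\frac{\left(p_j^{(s,N)}(x)\right)^2}{\|p_j^{(s,N)}\|^2},\qquad \|p\|^2=\int_{\mathbb{R}}p(x)^2\phi_N^{(s)}(x)\,dx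 .$$ *)

theory Defs
  imports "HOL-Analysis.Analysis" "HOL-Computational_Algebra.Polynomial"
begin

definition cauchy_weight :: "real \<Rightarrow> nat \<Rightarrow> real \<Rightarrow> real" where
  "cauchy_weight s N x = (1 + x\<^sup>2) powr (- s - real N)"

definition cauchy_inner :: "real \<Rightarrow> nat \<Rightarrow> real poly \<Rightarrow> real poly \<Rightarrow> real" where
  "cauchy_inner s N p q = (\<integral>x. poly p x * poly q x * cauchy_weight s N x \<partial>lborel)"

text \<open>
  The weight has only finitely many moments, so a family of orthogonal polynomials is
  considered for indices \<open>j < N\<close> only; for \<open>s > -1/2\<close> all the integrals
  that occur for such indices converge (lemma \<open>integrable_cauchy_inner\<close>).
\<close>

definition monic_orthogonal :: "real \<Rightarrow> nat \<Rightarrow> (nat \<Rightarrow> real poly) \<Rightarrow> bool" where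
  "monic_orthogonal s N P \<longleftrightarrow>
     (\<forall>j<N. degree (P j) = j \<and> lead_coeff (P j) = 1) \<and>
     (\<forall>i<N. \<forall>j<N. i \<noteq> j \<longrightarrow> cauchy_inner s N (P i) (P j) = 0)"

text \<open>
  For \<open>s > -1/2\<close> such a family exists and its members with index \<open>j < N\<close>
  are unique (lemmas \<open>monic_orthogonal_cauchy_poly\<close> and \<open>cauchy_poly_unique\<close>).
  The arbitrary members with index \<open>j \<ge> N\<close> do not enter the density.
\<close>

definition cauchy_poly :: "real \<Rightarrow> nat \<Rightarrow> nat \<Rightarrow> real poly" where
  "cauchy_poly s N = (SOME P. monic_orthogonal s N P)"

definition one_point_density :: "real \<Rightarrow> nat \<Rightarrow> real \<Rightarrow> real" where
  "one_point_density s N x = cauchy_weight s N x *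
     (\<Sum>j<N. (poly (cauchy_poly s N j) x)\<^sup>2
              / cauchy_inner s N (cauchy_poly s N j) (cauchy_poly s N j))"

definition cauchy_diff_op :: "real \<Rightarrow> nat \<Rightarrow> (real \<Rightarrow> real) \<Rightarrow> real \<Rightarrow> real" where
  "cauchy_diff_op s N y x =
     (1 + x\<^sup>2) ^ 3 * (deriv ^^ 3) y x
     + 8 * x * (1 + x\<^sup>2)\<^sup>2 * (deriv ^^ 2) y x
     + 2 * (1 + x\<^sup>2) * (3 + 2 * real N * (real N + 2 * s) + (7 - 2 * s\<^sup>2) * x\<^sup>2) * deriv y x
     + 4 * x * (1 + s\<^sup>2 + 2 * real N * (real N + 2 * s) + (1 - s\<^sup>2) * x\<^sup>2) * y x"


subsection \<open>Existence and uniqueness of the orthogonal polynomials\<close>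

lemma cauchy_weight_pos: "cauchy_weight s N x > 0"
proof -
  have "1 + x\<^sup>2 > 0" by (simp add: add_pos_nonneg)
  then show ?thesis by (simp add: cauchy_weight_def)
qed

lemma measurable_poly [measurable]: "(\<lambda>x. poly p (x::real)) \<in> borel_measurable borel"
  by (intro borel_measurable_continuous_onI continuous_intros)

lemma measurable_cauchy_weight [measurable]: "cauchy_weight s N \<in> borel_measurable borel"
  unfolding cauchy_weight_def by measurable

lemma integrable_one_plus_square_powr:
  fixes c :: real
  assumes "c > 1 / 2"
  shows "integrable lborel (\<lambda>x. (1 + x\<^sup>2) powr (- c))"
proof -
  let ?h = "\<lambda>x::real. indicator {1..} x * x powr (- (2 * c))"
  have "(\<lambda>x::real. x powr (- (2 * c))) integrable_on {1..}"
    using has_integral_powr_to_inf[of "- (2 * c)" 1] assms unfolding integrable_on_def by fastforce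
  then have "set_integrable lebesgue {1..} (\<lambda>x::real. x powr (- (2 * c)))"
    by (intro nonnegative_absolutely_integrable_1) auto
  then have h: "integrable lborel ?h"
    unfolding set_integrable_def by (subst (asm) integrable_completion) auto
  then have h': "integrable lborel (\<lambda>x. ?h (- x))"
    using lborel_integrable_real_affine[of ?h "-1" 0] by simp
  have i: "integrable lborel (\<lambda>x. indicator {-1..1::real} x :: real)" by simp
  show ?thesis
  proof (rule Bochner_Integration.integrable_bound)
    show "integrable lborel (\<lambda>x. indicator {-1..1} x + ?h x + ?h (- x))"
      using h h' i by (intro Bochner_Integration.integrable_add)
    show "AE x in lborel. norm ((1 + x\<^sup>2) powr (- c))
            \<le> norm (indicator {-1..1} x + ?h x + ?h (- x))"
    proof (rule AE_I2)
      fix x :: real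
      have nn: "(0::real) \<le> indicator {-1..1} x" "0 \<le> ?h x" "0 \<le> ?h (- x)" by auto
      have ge: "(1 + x\<^sup>2) powr (- c) \<le> indicator {-1..1} x + ?h x + ?h (- x)"
      proof (cases "\<bar>x\<bar> \<le> 1")
        case True
        have "(1 + x\<^sup>2) powr (- c) \<le> 1"
          using assms powr_mono[of "- c" 0 "1 + x\<^sup>2"] by (simp split: if_splits)
        moreover have "indicator {-1..1} x = (1::real)" using True by (auto simp: indicator_def)
        ultimately show ?thesis using nn by linarith
      next
        case False
        have "(1 + x\<^sup>2) powr (- c) \<le> (x\<^sup>2) powr (- c)"
          using False assms by (intro powr_mono2') auto
        also have "\<dots> = \<bar>x\<bar> powr (- (2 * c))"
          using powr_powr[of "\<bar>x\<bar>" 2 "- c"] False by (simp add: powr_numeral)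
        also have "\<dots> \<le> ?h x + ?h (- x)" using False by (auto simp: indicator_def)
        finally show ?thesis using nn by linarith
      qed
      show "norm ((1 + x\<^sup>2) powr (- c)) \<le> norm (indicator {-1..1} x + ?h x + ?h (- x))"
        using ge nn by simp
    qed
  qed auto
qed

lemma poly_abs_le:
  fixes p :: "real poly"
  assumes "degree p \<le> 2 * n"
  shows "\<bar>poly p x\<bar> \<le> (\<Sum>i\<le>degree p. \<bar>coeff p i\<bar>) * (1 + x\<^sup>2) ^ n"
proof -
  have m: "\<bar>x\<bar> ^ i \<le> (1 + x\<^sup>2) ^ n" if "i \<le> 2 * n" for i
  proof (cases "\<bar>x\<bar> \<le> 1")
    case True
    then have "\<bar>x\<bar> ^ i \<le> 1" by (simp add: power_le_one)
    also have "1 \<le> (1 + x\<^sup>2) ^ n" by (simp add: one_le_power)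
    finally show ?thesis .
  next
    case False
    then have "\<bar>x\<bar> ^ i \<le> \<bar>x\<bar> ^ (2 * n)" using that by (intro power_increasing) auto
    also have "\<dots> = (x\<^sup>2) ^ n" by (simp add: power_mult)
    also have "\<dots> \<le> (1 + x\<^sup>2) ^ n" by (intro power_mono) auto
    finally show ?thesis .
  qed
  have "\<bar>poly p x\<bar> \<le> (\<Sum>i\<le>degree p. \<bar>coeff p i * x ^ i\<bar>)"
    unfolding poly_altdef by (rule sum_abs)
  also have "\<dots> \<le> (\<Sum>i\<le>degree p. \<bar>coeff p i\<bar> * (1 + x\<^sup>2) ^ n)"
    using assms by (intro sum_mono) (auto simp: abs_mult power_abs intro!: mult_left_mono m)
  finally show ?thesis by (simp add: sum_distrib_right)
qed

lemma integrable_poly_cauchy_weight: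
  fixes p :: "real poly"
  assumes "s > - 1 / 2" and "n < N" and "degree p \<le> 2 * n"
  shows "integrable lborel (\<lambda>x. poly p x * cauchy_weight s N x)"
proof (rule Bochner_Integration.integrable_bound)
  let ?C = "\<Sum>i\<le>degree p. \<bar>coeff p i\<bar>"
  have "integrable lborel (\<lambda>x::real. (1 + x\<^sup>2) powr (- (s + 1)))"
    using assms(1) by (intro integrable_one_plus_square_powr) simp
  then show "integrable lborel (\<lambda>x::real. ?C * (1 + x\<^sup>2) powr (- (s + 1)))" by simp
  show "AE x in lborel. norm (poly p x * cauchy_weight s N x)
          \<le> norm (?C * (1 + x\<^sup>2) powr (- (s + 1)))"
  proof (rule AE_I2)
    fix x :: real
    have pos: "1 + x\<^sup>2 > 0" by (simp add: add_pos_nonneg)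
    have "norm (poly p x * cauchy_weight s N x) = \<bar>poly p x\<bar> * cauchy_weight s N x"
      using cauchy_weight_pos[of s N x] by (simp add: abs_mult)
    also have "\<dots> \<le> ?C * (1 + x\<^sup>2) ^ n * cauchy_weight s N x"
      using cauchy_weight_pos[of s N x] poly_abs_le[OF assms(3)]
      by (intro mult_right_mono) auto
    also have "\<dots> = ?C * (1 + x\<^sup>2) powr (real n - s - real N)"
      using pos by (simp add: cauchy_weight_def powr_realpow[symmetric] powr_add[symmetric]
          algebra_simps)
    also have "\<dots> \<le> ?C * (1 + x\<^sup>2) powr (- (s + 1))"
      using assms(2) by (intro mult_left_mono powr_mono sum_nonneg) auto
    finally show "norm (poly p x * cauchy_weight s N x)
          \<le> norm (?C * (1 + x\<^sup>2) powr (- (s + 1)))" by simp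
  qed
qed measurable

lemma integrable_cauchy_inner:
  fixes p q :: "real poly"
  assumes "s > - 1 / 2" and "degree p < N" and "degree q < N"
  shows "integrable lborel (\<lambda>x. poly p x * poly q x * cauchy_weight s N x)"
proof -
  have "degree (p * q) \<le> 2 * (N - 1)"
    using degree_mult_le[of p q] assms by linarith
  then show ?thesis
    using integrable_poly_cauchy_weight[of s "N - 1" N "p * q"] assms by simp
qed

lemma cauchy_inner_commute: "cauchy_inner s N p q = cauchy_inner s N q p"
  by (simp add: cauchy_inner_def mult.commute)

lemma cauchy_inner_diff_left:
  assumes "s > - 1 / 2" and "degree p < N" and "degree q < N" and "degree r < N"
  shows "cauchy_inner s N (p - q) r = cauchy_inner s N p r - cauchy_inner s N q r"
  using integrable_cauchy_inner[OF assms(1,2,4)] integrable_cauchy_inner[OF assms(1,3,4)]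
  by (simp add: cauchy_inner_def left_diff_distrib)

lemma cauchy_inner_smult_left: "cauchy_inner s N (smult c p) q = c * cauchy_inner s N p q"
  by (simp add: cauchy_inner_def mult.assoc)

lemma cauchy_inner_sum_left:
  assumes "s > - 1 / 2" and "\<And>i. i \<in> A \<Longrightarrow> degree (f i) < N" and "degree r < N"
  shows "cauchy_inner s N (\<Sum>i\<in>A. f i) r = (\<Sum>i\<in>A. cauchy_inner s N (f i) r)"
  using integrable_cauchy_inner[OF assms(1) _ assms(3)] assms(2)
  by (simp add: cauchy_inner_def poly_sum sum_distrib_right Bochner_Integration.integral_sum)

lemma cauchy_inner_pos:
  assumes "s > - 1 / 2" and "degree p < N" and "p \<noteq> 0"
  shows "cauchy_inner s N p p > 0"
proof -
  let ?f = "\<lambda>x. poly p x * poly p x * cauchy_weight s N x"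
  have int: "integrable lborel ?f" using assms by (intro integrable_cauchy_inner)
  have nn: "?f x \<ge> 0" for x using cauchy_weight_pos[of s N x] by simp
  have "cauchy_inner s N p p \<noteq> 0"
  proof
    assume "cauchy_inner s N p p = 0"
    then have "AE x in lborel. ?f x = 0"
      using integral_nonneg_eq_0_iff_AE[OF int] nn by (simp add: cauchy_inner_def)
    moreover have "?f x = 0 \<longleftrightarrow> poly p x = 0" for x
      using cauchy_weight_pos[of s N x] by simp
    ultimately have z: "AE x in lborel. poly p x = 0" by simp
    have "{x. poly p x = 0} \<in> null_sets lborel"
      using poly_roots_finite[OF assms(3)] by (rule finite_imp_null_set_lborel)
    then have "AE x in lborel. x \<notin> {x. poly p x = 0}" by (rule AE_not_in)
    with z have "AE x::real in lborel. x \<in> {}" by eventually_elim simp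
    then have "emeasure lborel (UNIV :: real set) = emeasure lborel ({} :: real set)"
      by (intro emeasure_eq_AE) auto
    then show False by simp
  qed
  moreover have "cauchy_inner s N p p \<ge> 0"
    unfolding cauchy_inner_def using nn by simp
  ultimately show ?thesis by simp
qed

lemma monic_orthogonal_exists:
  assumes "s > - 1 / 2"
  shows "\<exists>P. monic_orthogonal s N P"
proof -
  have "\<exists>P. (\<forall>j<n. degree (P j) = j \<and> lead_coeff (P j) = 1) \<and>
            (\<forall>i<n. \<forall>j<n. i \<noteq> j \<longrightarrow> cauchy_inner s N (P i) (P j) = 0)" if "n \<le> N" for n
    using that
  proof (induction n)
    case 0
    then show ?case by simp
  next
    case (Suc n)
    then obtain P where P: "\<And>j. j < n \<Longrightarrow> degree (P j) = j"
      "\<And>j. j < n \<Longrightarrow> lead_coeff (P j) = 1"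
      "\<And>i j. i < n \<Longrightarrow> j < n \<Longrightarrow> i \<noteq> j \<Longrightarrow> cauchy_inner s N (P i) (P j) = 0"
    proof -
      from Suc have "n \<le> N" by simp
      from Suc.IH[OF this] show ?thesis using that by blast
    qed
    define m where "m = monom (1::real) n"
    define c where "c i = cauchy_inner s N m (P i) / cauchy_inner s N (P i) (P i)" for i
    define S where "S = (\<Sum>i<n. smult (c i) (P i))"
    have dm: "degree m = n" by (simp add: m_def degree_monom_eq)
    have S: "S = 0 \<or> degree S < n"
    proof (cases "n = 0")
      case True
      then show ?thesis by (simp add: S_def)
    next
      case False
      then have "degree S < n" unfolding S_def
        by (intro degree_sum_less) (auto simp: P(1) intro: le_less_trans[OF degree_smult_le])
      then show ?thesis ..
    qed
    then have cS: "coeff S n = 0" by (auto simp: coeff_eq_0)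
    have dS: "degree S \<le> n" using S by auto
    have cn: "coeff (m - S) n = 1" using cS by (simp add: m_def)
    have "degree (m - S) \<le> n" using dm dS by (intro degree_diff_le) auto
    moreover have "n \<le> degree (m - S)" using cn by (intro le_degree) simp
    ultimately have dmS: "degree (m - S) = n" by simp
    have orth: "cauchy_inner s N (m - S) (P j) = 0" if j: "j < n" for j
    proof -
      have dj: "degree (P j) < N" using P(1)[OF j] j Suc.prems by simp
      have "P j \<noteq> 0" using P(2)[OF j] by auto
      then have pos: "cauchy_inner s N (P j) (P j) > 0" using assms dj by (intro cauchy_inner_pos)
      have "cauchy_inner s N S (P j) = (\<Sum>i<n. c i * cauchy_inner s N (P i) (P j))"
        unfolding S_def using assms dj P(1) Suc.prems
        by (subst cauchy_inner_sum_left) (auto simp: cauchy_inner_smult_left)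
      also have "\<dots> = (\<Sum>i<n. if i = j then c j * cauchy_inner s N (P j) (P j) else 0)"
        using P(3) j by (intro sum.cong) auto
      also have "\<dots> = cauchy_inner s N m (P j)" using j pos by (simp add: c_def)
      finally show ?thesis
        using assms dm dS dj Suc.prems by (subst cauchy_inner_diff_left) auto
    qed
    let ?Q = "P(n := m - S)"
    have "degree (?Q j) = j \<and> lead_coeff (?Q j) = 1" if "j < Suc n" for j
      using that P(1,2)[of j] dmS cn by (cases "j = n") auto
    moreover have "cauchy_inner s N (?Q i) (?Q j) = 0"
      if "i < Suc n" "j < Suc n" "i \<noteq> j" for i j
      using that P(3)[of i j] orth[of i] orth[of j] cauchy_inner_commute[of s N "m - S"]
      by (cases "i = n"; cases "j = n") auto
    ultimately show ?case by blast
  qed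
  from this[of N] show ?thesis by (simp add: monic_orthogonal_def)
qed

lemma monic_orthogonal_cauchy_poly:
  assumes "s > - 1 / 2"
  shows "monic_orthogonal s N (cauchy_poly s N)"
  unfolding cauchy_poly_def using monic_orthogonal_exists[OF assms] by (rule someI_ex)

lemma monic_orthogonal_lower_degree:
  assumes s: "s > - 1 / 2" and P: "monic_orthogonal s N P" and "j < N"
    and "degree q < j"
  shows "cauchy_inner s N q (P j) = 0"
  using \<open>degree q < j\<close>
proof (induction "degree q" arbitrary: q rule: less_induct)
  case less
  define k where "k = degree q"
  define r where "r = q - smult (lead_coeff q) (P k)"
  have k: "k < j" "k < N" using less.prems \<open>j < N\<close> by (auto simp: k_def)
  have dk: "degree (P k) = k" "lead_coeff (P k) = 1" and dj: "degree (P j) = j"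
    and o: "cauchy_inner s N (P k) (P j) = 0"
    using P k \<open>j < N\<close> unfolding monic_orthogonal_def by blast+
  have dr: "degree r \<le> k" unfolding r_def
    using dk by (intro degree_diff_le) (auto simp: k_def)
  have cr: "coeff r k = 0" using dk by (simp add: r_def k_def)
  have "cauchy_inner s N r (P j) = 0"
  proof (cases "r = 0")
    case True
    then show ?thesis by (simp add: cauchy_inner_def)
  next
    case False
    then have "degree r \<noteq> k" using cr by (metis leading_coeff_0_iff)
    then have "degree r < degree q" using dr by (simp add: k_def)
    then show ?thesis using less k by (simp add: k_def)
  qed
  moreover have "cauchy_inner s N r (P j)
      = cauchy_inner s N q (P j) - lead_coeff q * cauchy_inner s N (P k) (P j)"
    unfolding r_def using s k dk dj \<open>j < N\<close>
    by (subst cauchy_inner_diff_left) (auto simp: cauchy_inner_smult_left k_def)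
  ultimately show ?case using o by simp
qed

lemma cauchy_poly_unique:
  assumes s: "s > - 1 / 2" and P: "monic_orthogonal s N P" and "j < N"
  shows "P j = cauchy_poly s N j"
proof (rule ccontr)
  let ?R = "cauchy_poly s N"
  assume "P j \<noteq> ?R j"
  define d where "d = P j - ?R j"
  have R: "monic_orthogonal s N ?R" using s by (rule monic_orthogonal_cauchy_poly)
  have dP: "degree (P j) = j" "coeff (P j) j = 1" and dR: "degree (?R j) = j" "coeff (?R j) j = 1"
    using P R \<open>j < N\<close> unfolding monic_orthogonal_def by fastforce+
  have "d \<noteq> 0" using \<open>P j \<noteq> ?R j\<close> by (simp add: d_def)
  moreover have "degree d \<le> j" unfolding d_def using dP dR by (intro degree_diff_le) auto
  moreover have "coeff d j = 0" using dP dR by (simp add: d_def)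
  ultimately have dd: "degree d < j" by (metis leading_coeff_0_iff le_neq_implies_less)
  have "cauchy_inner s N d d = cauchy_inner s N (P j) d - cauchy_inner s N (?R j) d"
    using cauchy_inner_diff_left[OF s, of "P j" N "?R j" d] dP dR dd \<open>j < N\<close>
    by (simp add: d_def)
  also have "\<dots> = 0"
    using monic_orthogonal_lower_degree[OF s P \<open>j < N\<close> dd]
      monic_orthogonal_lower_degree[OF s R \<open>j < N\<close> dd] by (simp add: cauchy_inner_commute)
  finally show False
    using cauchy_inner_pos[OF s _ \<open>d \<noteq> 0\<close>, of N] dd \<open>j < N\<close> by simp
qed

end

theory Submission
  imports Defs
begin

text \<open>
  Put \<open>\<alpha> = s + N\<close>, \<open>\<sigma>(x) = 1 + x\<^sup>2\<close> and \<open>w = \<sigma>\<^sup>-\<^sup>\<alpha>\<close>. The weight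
  satisfies the Pearson equation \<open>(\<sigma> w)' = 2 (1 - \<alpha>) x w\<close>, so its orthogonal polynomials are
  classical: they are the monic Romanovski polynomials \<open>P\<^sub>j\<close>, given by a three-term recurrence
  with explicit coefficients. From the recurrence alone, \<open>\<sigma> P\<^sub>j'\<close> is a combination of
  \<open>x P\<^sub>j\<close> and \<open>P\<^sub>j\<^sub>+\<^sub>1\<close>, and \<open>\<sigma> P\<^sub>j\<^sub>+\<^sub>1'\<close> one of \<open>x P\<^sub>j\<^sub>+\<^sub>1\<close> and \<open>P\<^sub>j\<close>
  (\<open>romanovski_structure\<close>); eliminating \<open>P\<^sub>j\<^sub>+\<^sub>1\<close> gives the second-order differential
  equation of \<open>P\<^sub>j\<close> (\<open>romanovski_ode\<close>). Integration by parts
  (\<open>cauchy_integration_by_parts\<close>) turns these facts into orthogonality and into the ratio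
  of successive squared norms, and the Christoffel-Darboux formula then expresses the density through
  \<open>p = P\<^sub>N\<^sub>-\<^sub>1\<close> and \<open>q = P\<^sub>N\<close> only. With \<open>c = N (N + 2 s) / (2 s + 1)\<close> and the squared
  norm \<open>h\<close> of \<open>p\<close>, the density is \<open>T / \<sigma>\<close> (\<open>one_point_density_eq\<close>), where
  \<open>T = w (c p\<^sup>2 - 2 s x p q + (2 s + 1) q\<^sup>2) / h\<close>.

  The functions \<open>T\<close>, \<open>R = w p q / h\<close> and \<open>U = w (c p\<^sup>2 - (2 s + 1) q\<^sup>2) / h\<close>
  satisfy the closed linear system
  \<open>T' = - 2 s R\<close>, \<open>\<sigma> R' = U\<close>,
  \<open>\<sigma> U' = 2 s x T + (4 s\<^sup>2 x\<^sup>2 - 4 N (N + 2 s)) R\<close>,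
  and substituting \<open>T = \<sigma> y\<close> in it gives the third-order equation for the density \<open>y\<close>
  (\<open>third_order_of_system\<close>).

  The polynomial \<open>P\<^sub>N\<close> need not be square integrable against the weight, and \<open>p q w\<close> need not
  be integrable; the recurrence defines \<open>P\<^sub>N\<close> all the same, and only algebraic relations are used
  for it.
\<close>

section \<open>Monic Romanovski polynomials\<close>

text \<open>
  The coefficient of \<open>P\<^sub>j\<^sub>-\<^sub>1\<close> in \<open>(1 + x\<^sup>2) P\<^sub>j' - j x P\<^sub>j\<close>.
\<close>

definition lower_coeff :: "real \<Rightarrow> nat \<Rightarrow> real" where
  "lower_coeff \<alpha> j = real j * (2 * \<alpha> - real j) / (2 * \<alpha> - 2 * real j + 1)"

text \<open>
  The coefficient \<open>a\<^sub>j\<close> in the recurrence \<open>P\<^sub>j\<^sub>+\<^sub>1 = x P\<^sub>j - a\<^sub>j P\<^sub>j\<^sub>-\<^sub>1\<close>; for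
  polynomials orthogonal with respect to \<open>(1 + x\<^sup>2)\<^sup>-\<^sup>\<alpha>\<close> it is the ratio of the squared norms
  of \<open>P\<^sub>j\<close> and \<open>P\<^sub>j\<^sub>-\<^sub>1\<close>. The denominator is positive if \<open>\<alpha> > j + 1/2\<close>. For
  \<open>\<alpha> = s + N\<close> and \<open>s > - 1/2\<close> this covers all \<open>j < N\<close>, hence \<open>P\<^sub>0, \<dots>, P\<^sub>N\<close>.
\<close>

definition rec_coeff :: "real \<Rightarrow> nat \<Rightarrow> real" where
  "rec_coeff \<alpha> j = lower_coeff \<alpha> j / (2 * \<alpha> - 1 - 2 * real j)"

text \<open>
  The monic Romanovski polynomials (also called Routh-Romanovski or pseudo-Jacobi polynomials) for
  the even weight \<open>(1 + x\<^sup>2)\<^sup>-\<^sup>\<alpha>\<close>. No linear term occurs in the recurrence factor because the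
  weight is even.
\<close>

fun romanovski :: "real \<Rightarrow> nat \<Rightarrow> real poly" where
  "romanovski \<alpha> 0 = 1"
| "romanovski \<alpha> (Suc 0) = [:0, 1:]"
| "romanovski \<alpha> (Suc (Suc j)) =
     [:0, 1:] * romanovski \<alpha> (Suc j) - smult (rec_coeff \<alpha> (Suc j)) (romanovski \<alpha> j)"

lemma degree_romanovski: "degree (romanovski \<alpha> j) = j \<and> lead_coeff (romanovski \<alpha> j) = 1"
proof (induction \<alpha> j rule: romanovski.induct)
  case (3 \<alpha> j)
  let ?A = "[:0, 1:] * romanovski \<alpha> (Suc j)"
  let ?B = "smult (rec_coeff \<alpha> (Suc j)) (romanovski \<alpha> j)"
  have "romanovski \<alpha> (Suc j) \<noteq> 0" using 3 by auto
  then have A: "degree ?A = Suc (Suc j)" "lead_coeff ?A = 1"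
    using 3 by (auto simp: degree_mult_eq)
  have B: "degree ?B < degree ?A" using 3 A(1) by (simp add: le_less_trans[OF degree_smult_le])
  have "degree (?A - ?B) = degree ?A"
    using B degree_add_eq_left[of "- ?B" ?A] by simp
  moreover have "coeff ?B (degree ?A) = 0" using B by (rule coeff_eq_0)
  ultimately show ?case using A by (simp only: romanovski.simps coeff_diff) simp
qed auto

lemma rec_lower_coeff:
  assumes "\<alpha> > real j + 1 / 2"
  shows "(2 * \<alpha> - 1 - 2 * real j) * rec_coeff \<alpha> j = lower_coeff \<alpha> j"
  using assms by (simp add: rec_coeff_def)

lemma lower_coeff_Suc:
  assumes "\<alpha> > real j + 1 / 2"
  shows "1 + (2 * \<alpha> - 2 * real j + 1) * rec_coeff \<alpha> j = lower_coeff \<alpha> (Suc j)"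
proof -
  have "(2 * \<alpha> - 1 - 2 * real j) \<noteq> 0" "2 * \<alpha> - 2 * real j + 1 \<noteq> 0"
    "2 * \<alpha> - 2 * real (Suc j) + 1 = 2 * \<alpha> - 1 - 2 * real j"
    using assms by auto
  then show ?thesis
    unfolding rec_coeff_def lower_coeff_def by (simp add: divide_simps) (simp add: algebra_simps)
qed

text \<open>
  The two relations support each other in the induction: the second one for \<open>j + 1\<close> comes from
  differentiating the recurrence and inserting both relations for \<open>j\<close>; the first one for
  \<open>j + 1\<close> is the second one for \<open>j\<close> with \<open>P\<^sub>j\<close> eliminated by the recurrence. The
  coefficient in the second relation stays finite at the largest admissible index, where the denominator of
  the next recurrence coefficient may vanish.
\<close>

lemma romanovski_structure:
  assumes "\<alpha> > real j + 1 / 2"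
  shows "(1 + x\<^sup>2) * poly (pderiv (romanovski \<alpha> j)) x =
           (2 * \<alpha> - real j - 1) * x * poly (romanovski \<alpha> j) x
           - (2 * \<alpha> - 1 - 2 * real j) * poly (romanovski \<alpha> (Suc j)) x \<and>
         (1 + x\<^sup>2) * poly (pderiv (romanovski \<alpha> (Suc j))) x =
           real (Suc j) * x * poly (romanovski \<alpha> (Suc j)) x
           + lower_coeff \<alpha> (Suc j) * poly (romanovski \<alpha> j) x"
  using assms
proof (induction j)
  case 0
  then show ?case by (simp add: lower_coeff_def pderiv_pCons power2_eq_square algebra_simps)
next
  case (Suc j)
  let ?a = "rec_coeff \<alpha> (Suc j)"
  let ?p = "poly (romanovski \<alpha> j) x" and ?q = "poly (romanovski \<alpha> (Suc j)) x"
    and ?r = "poly (romanovski \<alpha> (Suc (Suc j))) x"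
  let ?p' = "poly (pderiv (romanovski \<alpha> j)) x" and ?q' = "poly (pderiv (romanovski \<alpha> (Suc j))) x"
    and ?r' = "poly (pderiv (romanovski \<alpha> (Suc (Suc j)))) x"
  have p': "(1 + x\<^sup>2) * ?p' = (2 * \<alpha> - real j - 1) * x * ?p - (2 * \<alpha> - 1 - 2 * real j) * ?q"
    and q': "(1 + x\<^sup>2) * ?q' = real (Suc j) * x * ?q + lower_coeff \<alpha> (Suc j) * ?p"
    using Suc by auto
  have a: "lower_coeff \<alpha> (Suc j) = (2 * \<alpha> - 1 - 2 * real (Suc j)) * ?a"
    using rec_lower_coeff[OF Suc.prems] by simp
  have c: "lower_coeff \<alpha> (Suc (Suc j)) = 1 + (2 * \<alpha> - 2 * real (Suc j) + 1) * ?a"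
    using lower_coeff_Suc[OF Suc.prems] by simp
  have r: "?r = x * ?q - ?a * ?p" by simp
  have r': "?r' = ?q + x * ?q' - ?a * ?p'"
    by (simp add: pderiv_diff pderiv_smult pderiv_pCons pderiv_mult)
  have "(1 + x\<^sup>2) * ?r' = (1 + x\<^sup>2) * ?q + x * ((1 + x\<^sup>2) * ?q') - ?a * ((1 + x\<^sup>2) * ?p')"
    unfolding r' by (simp only: ring_distribs mult_ac)
  also have "\<dots> = real (Suc (Suc j)) * x * ?r + lower_coeff \<alpha> (Suc (Suc j)) * ?q"
    unfolding p' q' r c a by (simp add: algebra_simps power2_eq_square)
  finally have "(1 + x\<^sup>2) * ?r' = real (Suc (Suc j)) * x * ?r + lower_coeff \<alpha> (Suc (Suc j)) * ?q" .
  moreover have "(1 + x\<^sup>2) * ?q' = (2 * \<alpha> - real (Suc j) - 1) * x * ?q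
      - (2 * \<alpha> - 1 - 2 * real (Suc j)) * ?r"
    unfolding q' r a by (simp add: algebra_simps)
  ultimately show ?case by blast
qed

lemmas romanovski_lower = romanovski_structure[THEN conjunct1]
lemmas romanovski_raise = romanovski_structure[THEN conjunct2]

text \<open>
  The second-order equation follows from the first-order system of \<open>romanovski_structure\<close> by
  eliminating \<open>P\<^sub>j\<^sub>+\<^sub>1\<close>.
\<close>

lemma romanovski_ode:
  assumes "\<alpha> > real j + 1 / 2"
  shows "(1 + x\<^sup>2) * poly (pderiv (pderiv (romanovski \<alpha> j))) x
           + 2 * (1 - \<alpha>) * x * poly (pderiv (romanovski \<alpha> j)) x
         = - (real j * (2 * \<alpha> - 1 - real j)) * poly (romanovski \<alpha> j) x"
proof -
  let ?p = "romanovski \<alpha> j" and ?q = "romanovski \<alpha> (Suc j)"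
  let ?c = "lower_coeff \<alpha> (Suc j)"
  define \<beta> where "\<beta> = 2 * \<alpha> - real j - 1"
  define d where "d = 2 * \<alpha> - 1 - 2 * real j"
  have dc: "d * ?c = real (Suc j) * \<beta>"
  proof -
    have "2 * \<alpha> - 2 * real (Suc j) + 1 = d" "d \<noteq> 0" "2 * \<alpha> - real (Suc j) = \<beta>"
      using assms by (auto simp: d_def \<beta>_def)
    then show ?thesis by (simp add: lower_coeff_def)
  qed
  have L: "(1 + x\<^sup>2) * poly (pderiv ?p) x = \<beta> * x * poly ?p x - d * poly ?q x" for x
    unfolding \<beta>_def d_def by (rule romanovski_lower[OF assms])
  have pd: "[:1, 0, 1:] * pderiv ?p = smult \<beta> ([:0, 1:] * ?p) - smult d ?q"
    using L by (intro poly_ext) (simp add: algebra_simps power2_eq_square)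
  have "(1 + x\<^sup>2) * poly (pderiv (pderiv ?p)) x + 2 * x * poly (pderiv ?p) x
      = poly (pderiv ([:1, 0, 1:] * pderiv ?p)) x"
    by (simp only: pderiv_mult poly_add poly_mult)
      (simp add: pderiv_pCons algebra_simps power2_eq_square)
  also have "\<dots> = \<beta> * poly ?p x + \<beta> * x * poly (pderiv ?p) x - d * poly (pderiv ?q) x"
    unfolding pd by (simp only: pderiv_mult pderiv_diff pderiv_smult poly_diff poly_smult poly_add poly_mult)
      (simp add: pderiv_pCons algebra_simps)
  finally have L': "(1 + x\<^sup>2) * poly (pderiv (pderiv ?p)) x + 2 * x * poly (pderiv ?p) x
      = \<beta> * poly ?p x + \<beta> * x * poly (pderiv ?p) x - d * poly (pderiv ?q) x" .
  \<comment> \<open>One factor \<open>1 + x\<^sup>2\<close> is redundant: the terms without derivatives combine to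
    \<open>- real j * \<beta> * (1 + x\<^sup>2) * P\<^sub>j\<close>, so it can be cancelled at the end.\<close>
  have "(1 + x\<^sup>2) * ((1 + x\<^sup>2) * poly (pderiv (pderiv ?p)) x + 2 * x * poly (pderiv ?p) x)
      = \<beta> * (1 + x\<^sup>2) * poly ?p x + \<beta> * x * ((1 + x\<^sup>2) * poly (pderiv ?p) x)
        - d * ((1 + x\<^sup>2) * poly (pderiv ?q) x)"
    unfolding L' by (simp add: algebra_simps)
  also have "\<dots> = \<beta> * (1 + x\<^sup>2) * poly ?p x + \<beta> * x * ((1 + x\<^sup>2) * poly (pderiv ?p) x)
        - real (Suc j) * x * (\<beta> * x * poly ?p x - (1 + x\<^sup>2) * poly (pderiv ?p) x)
        - real (Suc j) * \<beta> * poly ?p x"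
    unfolding romanovski_raise[OF assms] L dc[symmetric] by (simp add: algebra_simps)
  also have "\<dots> = (1 + x\<^sup>2) * ((\<beta> + real (Suc j)) * x * poly (pderiv ?p) x
        - real j * \<beta> * poly ?p x)"
    by (simp add: algebra_simps power2_eq_square)
  finally have "(1 + x\<^sup>2) * poly (pderiv (pderiv ?p)) x + 2 * x * poly (pderiv ?p) x
      = (\<beta> + real (Suc j)) * x * poly (pderiv ?p) x - real j * \<beta> * poly ?p x"
    by (smt (verit) mult_cancel_left sum_power2_gt_zero_iff zero_less_power2 power2_less_0)
  then show ?thesis unfolding \<beta>_def by (simp add: algebra_simps)
qed

section \<open>Orthogonality with respect to the Cauchy weight\<close>

lemma one_plus_square_pos: "(1::real) + x\<^sup>2 > 0"
  by (simp add: add_pos_nonneg)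

lemma DERIV_cauchy_weight:
  "(cauchy_weight s N has_field_derivative
     - 2 * (s + real N) * x * cauchy_weight s N x / (1 + x\<^sup>2)) (at x)"
proof -
  define a where "a = - s - real N"
  have "((\<lambda>x. (1 + x\<^sup>2) powr a) has_field_derivative
      2 * a * x * (1 + x\<^sup>2) powr a / (1 + x\<^sup>2)) (at x)"
    using one_plus_square_pos[of x]
    by (auto intro!: derivative_eq_intros simp: powr_diff field_simps)
  then show ?thesis unfolding cauchy_weight_def [abs_def] a_def by (simp add: algebra_simps)
qed

text \<open>
  The boundary term is of order \<open>(1 + x\<^sup>2)\<close> to the power \<open>1 + deg f / 2 - s - N\<close>, and by the
  degree bound this exponent is at most \<open>- 1/2 - s\<close>, hence negative. As the degree of \<open>f\<close>
  may be odd, the square of the boundary term is estimated.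
\<close>

lemma cauchy_boundary_limit:
  assumes "s > - 1 / 2" and "degree f + 3 \<le> 2 * N" and "F = at_top \<or> F = at_bot"
  shows "((\<lambda>x. (1 + x\<^sup>2) * poly f x * cauchy_weight s N x) \<longlongrightarrow> 0) F"
proof -
  define C where "C = (\<Sum>i\<le>degree (f * f). \<bar>coeff (f * f) i\<bar>)"
  let ?n = "2 * N - 3"
  have "filterlim (\<lambda>x::real. x\<^sup>2) at_top F"
    using assms(3) filterlim_pow_at_top[OF _ filterlim_ident, of 2]
      filterlim_pow_at_bot_even[OF _ filterlim_ident, of 2] by auto
  then have "filterlim (\<lambda>x::real. 1 + x\<^sup>2) at_top F"
    by (intro filterlim_tendsto_add_at_top[OF tendsto_const])
  then have "((\<lambda>x::real. (1 + x\<^sup>2) powr (- (1 + 2 * s))) \<longlongrightarrow> 0) F"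
    using assms(1) by (intro tendsto_neg_powr) auto
  then have lim: "((\<lambda>x::real. C * (1 + x\<^sup>2) powr (- (1 + 2 * s))) \<longlongrightarrow> 0) F"
    by (rule tendsto_mult_right_zero)
  have bound: "norm (((1 + x\<^sup>2) * poly f x * cauchy_weight s N x)\<^sup>2)
      \<le> C * (1 + x\<^sup>2) powr (- (1 + 2 * s))" for x
  proof -
    have "degree (f * f) \<le> 2 * ?n"
      using degree_mult_le[of f f] assms(2) by linarith
    then have "\<bar>poly (f * f) x\<bar> \<le> C * (1 + x\<^sup>2) ^ ?n"
      unfolding C_def by (rule poly_abs_le)
    then have "(poly f x)\<^sup>2 \<le> C * (1 + x\<^sup>2) ^ ?n" by (simp add: power2_eq_square)
    then have "(1 + x\<^sup>2)\<^sup>2 * (cauchy_weight s N x)\<^sup>2 * (poly f x)\<^sup>2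
        \<le> (1 + x\<^sup>2)\<^sup>2 * (cauchy_weight s N x)\<^sup>2 * (C * (1 + x\<^sup>2) ^ ?n)"
      by (intro mult_left_mono) auto
    also have "\<dots> = C * ((1 + x\<^sup>2) ^ (2 + ?n) * (cauchy_weight s N x)\<^sup>2)"
      by (simp only: power_add mult_ac)
    also have "(1 + x\<^sup>2) ^ (2 + ?n) * (cauchy_weight s N x)\<^sup>2
        = (1 + x\<^sup>2) powr (real (2 + ?n)) * (1 + x\<^sup>2) powr (2 * (- s - real N))"
      using one_plus_square_pos[of x] unfolding cauchy_weight_def
      by (simp only: powr_realpow power2_eq_square powr_add[symmetric]) (simp)
    also have "\<dots> = (1 + x\<^sup>2) powr (- (1 + 2 * s))"
      using assms(2) by (simp add: powr_add[symmetric] of_nat_diff)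
    finally show ?thesis by (simp add: power_mult_distrib mult_ac)
  qed
  have "((\<lambda>x. ((1 + x\<^sup>2) * poly f x * cauchy_weight s N x)\<^sup>2) \<longlongrightarrow> 0) F"
    using bound by (intro Lim_null_comparison[OF _ lim]) simp
  then show ?thesis by simp
qed

text \<open>
  The integrand is the derivative of \<open>(1 + x\<^sup>2) f w\<close>, by the Pearson equation of the weight.
\<close>

lemma cauchy_integration_by_parts:
  assumes "s > - 1 / 2" and "degree f + 3 \<le> 2 * N"
  shows "(\<integral>x. ((1 + x\<^sup>2) * poly (pderiv f) x + 2 * (1 - s - real N) * x * poly f x)
            * cauchy_weight s N x \<partial>lborel) = 0"
proof -
  define g where "g = [:1, 0, 1:] * pderiv f + smult (2 * (1 - s - real N)) ([:0, 1:] * f)"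
  let ?F = "\<lambda>x. (1 + x\<^sup>2) * poly f x * cauchy_weight s N x"
  let ?f = "\<lambda>x. poly g x * cauchy_weight s N x"
  have g: "poly g x = (1 + x\<^sup>2) * poly (pderiv f) x + 2 * (1 - s - real N) * x * poly f x" for x
    by (simp add: g_def algebra_simps power2_eq_square)
  have "degree ([:1, 0, 1:] * pderiv f) \<le> degree f + 1"
  proof (cases "degree f = 0")
    case True
    then have "pderiv f = 0" by (simp add: pderiv_eq_0_iff)
    then show ?thesis by simp
  next
    case False
    then show ?thesis
      using degree_mult_le[of "[:1, 0, 1:]" "pderiv f"] degree_pderiv[of f] by simp
  qed
  moreover have "degree (smult (2 * (1 - s - real N)) ([:0, 1:] * f)) \<le> degree f + 1"
    by (intro order.trans[OF degree_smult_le] order.trans[OF degree_mult_le]) simp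
  ultimately have "degree g \<le> degree f + 1" unfolding g_def by (rule degree_add_le)
  then have "degree g \<le> 2 * (N - 1)" using assms(2) by linarith
  then have int: "integrable lborel ?f"
    using assms by (intro integrable_poly_cauchy_weight[of s "N - 1"]) auto
  have "(?F has_vector_derivative ?f x) (at x)" for x
  proof -
    define w' where "w' = - 2 * (s + real N) * x * cauchy_weight s N x / (1 + x\<^sup>2)"
    have w: "(cauchy_weight s N has_field_derivative w') (at x)"
      unfolding w'_def by (rule DERIV_cauchy_weight)
    have "(1 + x\<^sup>2) * w' = - 2 * (s + real N) * x * cauchy_weight s N x"
      using one_plus_square_pos[of x] by (simp add: w'_def)
    then have "2 * x * poly f x * cauchy_weight s N x
        + (1 + x\<^sup>2) * poly (pderiv f) x * cauchy_weight s N x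
        + (1 + x\<^sup>2) * w' * poly f x = ?f x"
      unfolding g by algebra
    then have "(?F has_field_derivative ?f x) (at x)"
      by (auto intro!: derivative_eq_intros w simp: algebra_simps)
    then show ?thesis by (simp add: has_real_derivative_iff_has_vector_derivative)
  qed
  moreover have "isCont ?f x" for x
    by (intro continuous_intros DERIV_isCont[OF DERIV_cauchy_weight])
  ultimately have "(LBINT x=-\<infinity>..\<infinity>. ?f x) = 0 - 0"
    using int cauchy_boundary_limit[OF assms]
    by (intro interval_integral_FTC_integrable[where F = ?F])
      (auto simp: ereal_tendsto_simps set_integrable_def)
  then show ?thesis
    by (simp add: interval_lebesgue_integral_def set_lebesgue_integral_def g)
qed

text \<open>
  Self-adjointness: for \<open>f = P\<^sub>i' P\<^sub>j - P\<^sub>i P\<^sub>j'\<close> the integrand of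
  \<open>cauchy_integration_by_parts\<close> is the difference of the eigenvalues times
  \<open>P\<^sub>i P\<^sub>j w\<close>, and the eigenvalues are distinct.
\<close>

lemma romanovski_orthogonal:
  assumes "s > - 1 / 2" and "i < N" and "j < N" and "i \<noteq> j"
  shows "cauchy_inner s N (romanovski (s + real N) i) (romanovski (s + real N) j) = 0"
proof -
  define \<alpha> where "\<alpha> = s + real N"
  define p where "p = romanovski \<alpha> i"
  define q where "q = romanovski \<alpha> j"
  define ev where "ev k = real k * (2 * \<alpha> - 1 - real k)" for k
  let ?f = "pderiv p * q - p * pderiv q"
  have deg: "degree p = i" "degree q = j"
    using degree_romanovski by (auto simp: p_def q_def)
  have "degree ?f \<le> i + j"
    using deg degree_mult_le[of "pderiv p" q] degree_mult_le[of p "pderiv q"]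
      degree_pderiv[of p] degree_pderiv[of q]
    by (intro degree_diff_le) auto
  then have "degree ?f + 3 \<le> 2 * N" using assms by linarith
  from cauchy_integration_by_parts[OF assms(1) this]
  have "(\<integral>x. ((1 + x\<^sup>2) * poly (pderiv ?f) x + 2 * (1 - \<alpha>) * x * poly ?f x)
          * cauchy_weight s N x \<partial>lborel) = 0"
    by (simp add: \<alpha>_def algebra_simps)
  moreover have "(1 + x\<^sup>2) * poly (pderiv ?f) x + 2 * (1 - \<alpha>) * x * poly ?f x
      = (ev j - ev i) * (poly p x * poly q x)" for x
  proof -
    have "\<alpha> > real i + 1 / 2" "\<alpha> > real j + 1 / 2"
      using assms by (auto simp: \<alpha>_def)
    from this[THEN romanovski_ode, of x]
    have pq: "(1 + x\<^sup>2) * poly (pderiv (pderiv p)) x + 2 * (1 - \<alpha>) * x * poly (pderiv p) x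
          = - ev i * poly p x"
      "(1 + x\<^sup>2) * poly (pderiv (pderiv q)) x + 2 * (1 - \<alpha>) * x * poly (pderiv q) x
          = - ev j * poly q x"
      by (simp_all add: p_def q_def ev_def)
    have "(1 + x\<^sup>2) * poly (pderiv ?f) x + 2 * (1 - \<alpha>) * x * poly ?f x
      = ((1 + x\<^sup>2) * poly (pderiv (pderiv p)) x + 2 * (1 - \<alpha>) * x * poly (pderiv p) x) * poly q x
      - poly p x * ((1 + x\<^sup>2) * poly (pderiv (pderiv q)) x + 2 * (1 - \<alpha>) * x * poly (pderiv q) x)"
      by (simp add: pderiv_diff pderiv_mult algebra_simps)
    then show ?thesis unfolding pq by (simp add: algebra_simps)
  qed
  ultimately have "(ev j - ev i) * cauchy_inner s N p q = 0"
    by (simp add: cauchy_inner_def mult.assoc)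
  moreover have "ev j - ev i = (real j - real i) * (2 * \<alpha> - 1 - real i - real j)"
    by (simp add: ev_def algebra_simps)
  moreover have "2 * \<alpha> - 1 - real i - real j > 0"
    using assms by (simp add: \<alpha>_def)
  ultimately show ?thesis using assms(4) by (simp add: p_def q_def \<alpha>_def)
qed

lemma cauchy_poly_eq_romanovski:
  assumes "s > - 1 / 2" and "j < N"
  shows "cauchy_poly s N j = romanovski (s + real N) j"
proof -
  have "monic_orthogonal s N (romanovski (s + real N))"
    unfolding monic_orthogonal_def
    using degree_romanovski romanovski_orthogonal[OF assms(1)] by blast
  from cauchy_poly_unique[OF assms(1) this assms(2)] show ?thesis by simp
qed

text \<open>
  Here \<open>cauchy_integration_by_parts\<close> is applied to \<open>P\<^sub>j P\<^sub>j\<^sub>+\<^sub>1\<close>. The usual argument through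
  \<open>\<langle>x P\<^sub>j\<^sub>+\<^sub>1, P\<^sub>j\<rangle>\<close> needs \<open>P\<^sub>j\<^sub>+\<^sub>2\<close> to be orthogonal to \<open>P\<^sub>j\<close>, which is
  not covered by \<open>romanovski_orthogonal\<close> at the last index \<open>j + 2 = N\<close>.
\<close>

lemma romanovski_norm_Suc:
  fixes s :: real and N :: nat
  defines "\<alpha> \<equiv> s + real N"
  defines "h \<equiv> \<lambda>j. cauchy_inner s N (romanovski \<alpha> j) (romanovski \<alpha> j)"
  assumes "s > - 1 / 2" and "Suc j < N"
  shows "h (Suc j) = rec_coeff \<alpha> (Suc j) * h j"
proof -
  let ?p = "romanovski \<alpha> j" and ?q = "romanovski \<alpha> (Suc j)"
  let ?c = "lower_coeff \<alpha> (Suc j)" and ?w = "cauchy_weight s N"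
  define d where "d = 2 * \<alpha> - 1 - 2 * real (Suc j)"
  have \<alpha>: "\<alpha> > real j + 1 / 2" "\<alpha> > real (Suc j) + 1 / 2"
    using assms by auto
  have deg: "degree ?p = j" "degree ?q = Suc j"
    using degree_romanovski by blast+
  \<comment> \<open>\<open>r\<close> is the lower term \<open>a\<^sub>j P\<^sub>j\<^sub>-\<^sub>1\<close> of the recurrence, and 0 if \<open>j = 0\<close>.\<close>
  obtain r where r: "[:0, 1:] * ?p = ?q + r" "degree r < N" "cauchy_inner s N r ?q = 0"
  proof (cases j)
    case 0
    then show ?thesis using that[of 0] assms by (simp add: cauchy_inner_def)
  next
    case (Suc i)
    have "degree (romanovski \<alpha> i) < N" "cauchy_inner s N (romanovski \<alpha> i) ?q = 0"
      using degree_romanovski[of \<alpha> i] romanovski_orthogonal[of s i N "Suc j"] assms Suc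
      by (auto simp: \<alpha>_def)
    then show ?thesis
      using that[of "smult (rec_coeff \<alpha> j) (romanovski \<alpha> i)"] Suc
      by (simp add: cauchy_inner_smult_left le_less_trans[OF degree_smult_le])
  qed
  have "degree (?p * ?q) + 3 \<le> 2 * N"
    using degree_mult_le[of ?p ?q] deg assms by linarith
  from cauchy_integration_by_parts[OF assms(3) this]
  have "0 = (\<integral>x. ((1 + x\<^sup>2) * poly (pderiv (?p * ?q)) x + 2 * (1 - \<alpha>) * x * poly (?p * ?q) x)
          * ?w x \<partial>lborel)"
    by (simp add: \<alpha>_def algebra_simps)
  also have "\<dots> = (\<integral>x. ?c * (poly ?p x * poly ?p x * ?w x) - d * (poly ?q x * poly ?q x * ?w x)
      + 2 * (poly r x * poly ?q x * ?w x) \<partial>lborel)"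
  proof (rule Bochner_Integration.integral_cong [OF refl])
    fix x
    have "poly ([:0, 1:] * ?p) x = poly (?q + r) x" using r(1) by (rule arg_cong)
    then have rx: "poly r x = x * poly ?p x - poly ?q x" by simp
    have E: "(1 + x\<^sup>2) * poly (pderiv (?p * ?q)) x
        = ((1 + x\<^sup>2) * poly (pderiv ?p) x) * poly ?q x + poly ?p x * ((1 + x\<^sup>2) * poly (pderiv ?q) x)"
      unfolding pderiv_mult poly_add poly_mult by (simp add: algebra_simps)
    show "((1 + x\<^sup>2) * poly (pderiv (?p * ?q)) x + 2 * (1 - \<alpha>) * x * poly (?p * ?q) x) * ?w x
      = ?c * (poly ?p x * poly ?p x * ?w x) - d * (poly ?q x * poly ?q x * ?w x)
      + 2 * (poly r x * poly ?q x * ?w x)"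
      unfolding E romanovski_lower[OF \<alpha>(1)] romanovski_raise[OF \<alpha>(1)] rx d_def poly_mult
      by (simp add: algebra_simps)
  qed
  also have "\<dots> = ?c * h j - d * h (Suc j) + 2 * cauchy_inner s N r ?q"
    using integrable_cauchy_inner[OF assms(3), of ?p N ?p] integrable_cauchy_inner[OF assms(3), of ?q N ?q]
      integrable_cauchy_inner[OF assms(3), of r N ?q] r(2) deg assms(4)
    unfolding h_def cauchy_inner_def by simp
  finally have "d * h (Suc j) = ?c * h j" using r(3) by simp
  then show ?thesis
    using \<alpha>(2) rec_lower_coeff[OF \<alpha>(2)] by (simp add: d_def rec_coeff_def field_simps)
qed

section \<open>The density in terms of two consecutive polynomials\<close>

text \<open>
  The confluent Christoffel-Darboux formula, for an arbitrary sequence \<open>h\<close> in the role of the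
  squared norms whose successive ratios are the recurrence coefficients.
\<close>

lemma romanovski_Christoffel_Darboux:
  assumes "\<And>j. j < n \<Longrightarrow> h (Suc j) = rec_coeff \<alpha> (Suc j) * h j"
    and "\<And>j. j \<le> n \<Longrightarrow> h j \<noteq> 0"
  shows "h n * (\<Sum>j\<le>n. (poly (romanovski \<alpha> j) x)\<^sup>2 / h j) =
    poly (pderiv (romanovski \<alpha> (Suc n))) x * poly (romanovski \<alpha> n) x
    - poly (romanovski \<alpha> (Suc n)) x * poly (pderiv (romanovski \<alpha> n)) x"
  using assms
proof (induction n)
  case 0
  then show ?case by (simp add: pderiv_pCons)
next
  case (Suc n)
  let ?p = "romanovski \<alpha> n" and ?q = "romanovski \<alpha> (Suc n)"
  let ?a = "rec_coeff \<alpha> (Suc n)"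
  have "h (Suc n) * (\<Sum>j\<le>Suc n. (poly (romanovski \<alpha> j) x)\<^sup>2 / h j)
      = ?a * (h n * (\<Sum>j\<le>n. (poly (romanovski \<alpha> j) x)\<^sup>2 / h j)) + (poly ?q x)\<^sup>2"
    using Suc.prems(2)[of "Suc n"] unfolding sum.atMost_Suc ring_distribs
    by (subst Suc.prems(1)) (simp_all add: mult.assoc)
  also have "\<dots> = ?a * (poly (pderiv ?q) x * poly ?p x - poly ?q x * poly (pderiv ?p) x)
      + (poly ?q x)\<^sup>2"
    using Suc by simp
  also have "\<dots> = poly (pderiv (romanovski \<alpha> (Suc (Suc n)))) x * poly ?q x
      - poly (romanovski \<alpha> (Suc (Suc n))) x * poly (pderiv ?q) x"
    by (simp add: pderiv_diff pderiv_smult pderiv_pCons algebra_simps power2_eq_square)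
  finally show ?case .
qed

text \<open>
  The derivatives in the Christoffel-Darboux formula are removed with \<open>romanovski_structure\<close>.
\<close>

lemma one_point_density_eq:
  fixes s :: real and n :: nat
  defines "\<alpha> \<equiv> s + real (Suc n)"
  defines "p \<equiv> poly (romanovski \<alpha> n)" and "q \<equiv> poly (romanovski \<alpha> (Suc n))"
    and "c \<equiv> lower_coeff \<alpha> (Suc n)"
    and "h \<equiv> cauchy_inner s (Suc n) (romanovski \<alpha> n) (romanovski \<alpha> n)"
  assumes "s > - 1 / 2"
  shows "one_point_density s (Suc n) x =
    cauchy_weight s (Suc n) x * (c * p x ^ 2 - 2 * s * x * p x * q x + (2 * s + 1) * q x ^ 2) / h
      / (1 + x\<^sup>2)"
proof -
  define k where "k j = cauchy_inner s (Suc n) (romanovski \<alpha> j) (romanovski \<alpha> j)" for j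
  have \<alpha>: "\<alpha> > real n + 1 / 2" using assms by simp
  have nz: "k j \<noteq> 0" if "j \<le> n" for j
  proof -
    have "degree (romanovski \<alpha> j) < Suc n" "romanovski \<alpha> j \<noteq> 0"
      using degree_romanovski[of \<alpha> j] that by auto
    then show ?thesis using cauchy_inner_pos[OF \<open>s > - 1 / 2\<close>] unfolding k_def by fastforce
  qed
  have h: "k n = h" "h \<noteq> 0" using nz[of n] by (auto simp: k_def h_def)
  have cd: "h * (\<Sum>j\<le>n. (poly (romanovski \<alpha> j) x)\<^sup>2 / k j) =
    poly (pderiv (romanovski \<alpha> (Suc n))) x * p x - q x * poly (pderiv (romanovski \<alpha> n)) x"
    unfolding h(1)[symmetric] p_def q_def
    using romanovski_norm_Suc[OF \<open>s > - 1 / 2\<close>, of _ "Suc n"] nz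
    by (intro romanovski_Christoffel_Darboux) (auto simp: k_def \<alpha>_def)
  have "(1 + x\<^sup>2) * (poly (pderiv (romanovski \<alpha> (Suc n))) x * p x
        - q x * poly (pderiv (romanovski \<alpha> n)) x)
      = ((1 + x\<^sup>2) * poly (pderiv (romanovski \<alpha> (Suc n))) x) * p x
        - q x * ((1 + x\<^sup>2) * poly (pderiv (romanovski \<alpha> n)) x)"
    by (simp only: algebra_simps)
  also have "\<dots> = c * p x ^ 2 - 2 * s * x * p x * q x + (2 * s + 1) * q x ^ 2"
    unfolding romanovski_lower[OF \<alpha>] romanovski_raise[OF \<alpha>] c_def p_def q_def
    by (simp add: \<alpha>_def algebra_simps power2_eq_square)
  finally have g: "(1 + x\<^sup>2) * (h * (\<Sum>j\<le>n. (poly (romanovski \<alpha> j) x)\<^sup>2 / k j))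
      = c * p x ^ 2 - 2 * s * x * p x * q x + (2 * s + 1) * q x ^ 2"
    unfolding cd .
  have "one_point_density s (Suc n) x
      = cauchy_weight s (Suc n) x * (\<Sum>j\<le>n. (poly (romanovski \<alpha> j) x)\<^sup>2 / k j)"
    using cauchy_poly_eq_romanovski[OF \<open>s > - 1 / 2\<close>, of _ "Suc n"]
    by (simp add: one_point_density_def k_def \<alpha>_def lessThan_Suc_atMost)
  also have "\<dots> = cauchy_weight s (Suc n) x
      * ((1 + x\<^sup>2) * (h * (\<Sum>j\<le>n. (poly (romanovski \<alpha> j) x)\<^sup>2 / k j))) / h / (1 + x\<^sup>2)"
    using h(2) one_plus_square_pos[of x] by simp
  finally show ?thesis unfolding g .
qed

section \<open>The third-order differential equation\<close>

text \<open>
  Eliminating \<open>R\<close> and \<open>U\<close> gives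
  \<open>\<sigma> (\<sigma> T'')' + 4 s\<^sup>2 x T + (4 N (N + 2 s) - 4 s\<^sup>2 x\<^sup>2) T' = 0\<close> with \<open>\<sigma> = 1 + x\<^sup>2\<close>,
  also for \<open>s = 0\<close>, where \<open>T\<close> is constant; the operator of the theorem is this one composed
  with \<open>y \<mapsto> \<sigma> y\<close>. The proof computes the three derivatives of \<open>y = T / \<sigma>\<close> explicitly,
  which also shows that they exist. They are written with the auxiliary function
  \<open>v = 1 / \<sigma>\<close>, for which \<open>v' = - 2 x v\<^sup>2\<close>, so that they are polynomial expressions.
\<close>

lemma third_order_of_system:
  fixes T R U :: "real \<Rightarrow> real"
  assumes T: "\<And>x. (T has_field_derivative - 2 * s * R x) (at x)"
    and R: "\<And>x. (R has_field_derivative U x / (1 + x\<^sup>2)) (at x)"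
    and U: "\<And>x. (U has_field_derivative
        (2 * s * x * T x + (4 * s\<^sup>2 * x\<^sup>2 - 4 * real N * (real N + 2 * s)) * R x) / (1 + x\<^sup>2)) (at x)"
    and y: "y = (\<lambda>x. T x / (1 + x\<^sup>2))"
  shows "(\<forall>k<3. \<forall>x. (deriv ^^ k) y field_differentiable at x) \<and>
         (\<forall>x. cauchy_diff_op s N y x = 0)"
proof -
  define v where "v x = 1 / (1 + x\<^sup>2)" for x :: real
  define W where "W x = 2 * s * x * T x + (4 * s\<^sup>2 * x\<^sup>2 - 4 * real N * (real N + 2 * s)) * R x" for x
  define y1 where "y1 x = - 2 * s * R x * v x - 2 * x * T x * v x ^ 2" for x
  define y2 where "y2 x = (8 * s * x * R x - 2 * s * U x - 2 * T x) * v x ^ 2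
      + 8 * x ^ 2 * T x * v x ^ 3" for x
  define y3 where "y3 x = (12 * s * R x + 8 * s * x * U x * v x - 2 * s * W x * v x) * v x ^ 2
      + (16 * x * T x - 16 * s * x ^ 2 * R x - 4 * x * (8 * s * x * R x - 2 * s * U x - 2 * T x))
        * v x ^ 3 - 48 * x ^ 3 * T x * v x ^ 4" for x
  have yv: "y = (\<lambda>x. T x * v x)" by (simp add: y v_def)
  have gv: "(1 + x\<^sup>2) * v x = 1" for x
    using one_plus_square_pos[of x] by (simp add: v_def)
  have v': "(v has_field_derivative - 2 * x * v x ^ 2) (at x)" for x
    unfolding v_def [abs_def] using one_plus_square_pos[of x]
    by (auto intro!: derivative_eq_intros simp: power2_eq_square)
  have R': "(R has_field_derivative U x * v x) (at x)"
    and U': "(U has_field_derivative W x * v x) (at x)" for x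
    using R[of x] U[of x] by (simp_all add: v_def W_def)
  note [derivative_intros] = T v' R' U'
  have d0: "(y has_field_derivative y1 x) (at x)" for x
    unfolding yv y1_def by (rule derivative_eq_intros refl)+ (simp add: algebra_simps)
  have d1: "(y1 has_field_derivative y2 x) (at x)" for x
    unfolding y1_def [abs_def] y2_def
    by (rule derivative_eq_intros refl)+ (simp add: algebra_simps power2_eq_square power3_eq_cube)
  have d2: "(y2 has_field_derivative y3 x) (at x)" for x
    unfolding y2_def [abs_def] y3_def
    by (rule derivative_eq_intros refl)+
      (simp add: algebra_simps power2_eq_square power3_eq_cube power4_eq_xxxx)
  have e1: "deriv y = y1" and e2: "deriv y1 = y2" and e3: "deriv y2 = y3"
    using d0 d1 d2 by (auto intro!: ext DERIV_imp_deriv)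
  have k: "deriv y = y1" "(deriv ^^ 2) y = y2" "(deriv ^^ 3) y = y3"
    by (simp_all add: e1 e2 e3 numeral_2_eq_2 numeral_3_eq_3)
  have "(deriv ^^ k) y field_differentiable at x" if "k < 3" for k x
  proof -
    have "k = 0 \<or> k = 1 \<or> k = 2" using that by auto
    then show ?thesis using d0[of x] d1[of x] d2[of x] k(2)
      by (auto simp: field_differentiable_def e1)
  qed
  moreover have "cauchy_diff_op s N y x = 0" for x
  proof -
    have "(1 + x\<^sup>2) ^ 3 * y3 x + 8 * x * (1 + x\<^sup>2)\<^sup>2 * y2 x
     + 2 * (1 + x\<^sup>2) * (3 + 2 * real N * (real N + 2 * s) + (7 - 2 * s\<^sup>2) * x\<^sup>2) * y1 x
     + 4 * x * (1 + s\<^sup>2 + 2 * real N * (real N + 2 * s) + (1 - s\<^sup>2) * x\<^sup>2) * (T x * v x) = 0"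
      using gv[of x] unfolding y1_def y2_def y3_def W_def by algebra
    then show ?thesis unfolding cauchy_diff_op_def k unfolding yv .
  qed
  ultimately show ?thesis by blast
qed

theorem proposition5p1:
  fixes N :: nat and s :: real
  assumes "N \<ge> 1" and "s > - 1 / 2"
  shows "(\<forall>k<3. \<forall>x::real. (deriv ^^ k) (one_point_density s N) field_differentiable at x)
       \<and> (\<forall>x::real. cauchy_diff_op s N (one_point_density s N) x = 0)"
proof -
  obtain n where N: "N = Suc n" using assms(1) by (cases N) auto
  define \<alpha> where "\<alpha> = s + real (Suc n)"
  define w where "w = cauchy_weight s (Suc n)"
  define p where "p = poly (romanovski \<alpha> n)"
  define q where "q = poly (romanovski \<alpha> (Suc n))"
  define c where "c = lower_coeff \<alpha> (Suc n)"
  define h where "h = cauchy_inner s (Suc n) (romanovski \<alpha> n) (romanovski \<alpha> n)"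
  define k where "k = 1 / h"
  define v where "v x = 1 / (1 + x\<^sup>2)" for x :: real
  define T where
    "T x = w x * (c * p x ^ 2 - 2 * s * x * p x * q x + (2 * s + 1) * q x ^ 2) * k" for x
  define R where "R x = w x * p x * q x * k" for x
  define U where "U x = w x * (c * p x ^ 2 - (2 * s + 1) * q x ^ 2) * k" for x
  have \<alpha>: "\<alpha> > real n + 1 / 2" using assms by (simp add: \<alpha>_def)
  have c: "(2 * s + 1) * c = real N * (real N + 2 * s)"
    using assms by (simp add: c_def lower_coeff_def \<alpha>_def N field_simps)
  have p': "(p has_field_derivative
      ((real N + 2 * s) * x * p x - (2 * s + 1) * q x) * v x) (at x)" for x
  proof -
    have "poly (pderiv (romanovski \<alpha> n)) x = ((real N + 2 * s) * x * p x - (2 * s + 1) * q x) * v x"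
      using romanovski_lower[OF \<alpha>, of x] one_plus_square_pos[of x]
      by (simp add: v_def p_def q_def \<alpha>_def N field_simps)
    then show ?thesis using poly_DERIV[of "romanovski \<alpha> n" x] by (simp add: p_def)
  qed
  have q': "(q has_field_derivative (real N * x * q x + c * p x) * v x) (at x)" for x
  proof -
    have "poly (pderiv (romanovski \<alpha> (Suc n))) x = (real N * x * q x + c * p x) * v x"
      using romanovski_raise[OF \<alpha>, of x] one_plus_square_pos[of x]
      by (simp add: v_def p_def q_def c_def N field_simps del: romanovski.simps)
    then show ?thesis using poly_DERIV[of "romanovski \<alpha> (Suc n)" x] by (simp add: q_def)
  qed
  have w': "(w has_field_derivative - 2 * (s + real N) * x * w x * v x) (at x)" for x
    using DERIV_cauchy_weight[of s N x] by (simp add: w_def N v_def)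
  note [derivative_intros] = p' q' w'
  show ?thesis
  proof (rule third_order_of_system[of T s R U])
    fix x
    show "(T has_field_derivative - 2 * s * R x) (at x)"
      unfolding T_def [abs_def] R_def
      by (rule derivative_eq_intros refl)+ (simp add: algebra_simps power2_eq_square)
    have "(R has_field_derivative U x * v x) (at x)"
      unfolding R_def [abs_def] U_def
      by (rule derivative_eq_intros refl)+ (simp add: algebra_simps power2_eq_square)
    then show "(R has_field_derivative U x / (1 + x\<^sup>2)) (at x)" by (simp add: v_def)
    have "(U has_field_derivative (2 * s * x * T x
        + (4 * s\<^sup>2 * x\<^sup>2 - 4 * ((2 * s + 1) * c)) * R x) * v x) (at x)"
      unfolding U_def [abs_def] T_def R_def
      by (rule derivative_eq_intros refl)+ (simp add: algebra_simps power2_eq_square)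
    then show "(U has_field_derivative (2 * s * x * T x
        + (4 * s\<^sup>2 * x\<^sup>2 - 4 * real N * (real N + 2 * s)) * R x) / (1 + x\<^sup>2)) (at x)"
      unfolding c by (simp add: v_def mult.assoc)
  next
    show "one_point_density s N = (\<lambda>x. T x / (1 + x\<^sup>2))"
      unfolding N T_def k_def w_def p_def q_def c_def h_def \<alpha>_def
      using one_point_density_eq[OF assms(2)] by (intro ext) simp
  qed
qed

end
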